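(* Let $L$ be a left pre-Lie algebra over a field $F$, and let $B$, $C$ be ideals of $L$ such that $L = B + C$, $B = \zeta_2(B)$ and $C = \zeta_2(C)$. Put $D = B\cap C$. Then the following assertions hold. (i) $\zeta_1(B)\cap\zeta_1(C)\le \zeta_1(L)$. (ii) $B\cdot(C\cdot D)\le \zeta_1(B)\cap\zeta_1(C)$ and $C\cdot(B\cdot D)\le \zeta_1(B)\cap\zeta_1(C)$. (iii) $L\cdot D = B\cdot D + C\cdot D\le (D\cap\zeta_1(B)) + (D\cap\zeta_1(C))\le \zeta_1(D)$. (iv) $L\cdot(B\cdot D + C\cdot D)\le B\cdot(C\cdot D) + C\cdot(B\cdot D)\le \zeta_1(B)\cap\zeta_1(C)\le\zeta_1(L)$; in particular, $B\cdot(C\cdot D) + C\cdot(B\cdot D)$ is an ideal of $L$. (v) $L\cdot(L\cdot(L\cdot D)) = \langle 0\rangle$. (vi) $L^6 = \langle 0\rangle$. (vii) $D\cdot L\le D\cdot B + D\cdot C\le (D\cap\zeta_1(B)) + (D\cap\zeta_1(C))\le\zeta_1(D)$. (viii) $(D\cap\zeta_1(B)) + (D\cap\zeta_1(C))$ is an abelian ideal of $L$. (ix) $\zeta_1(D)$ is an ideal of $L$. (x) $(D\cdot L)\cdot L\le (D\cdot C)\cdot B + (D\cdot B)\cdot C\le (D\cap\zeta_1(B)) + (D\cap\zeta_1(C))\le \zeta_1(D)$ and $((D\cdot L)\cdot L)\cdot L\le (D\cdot C)\cdot B + (D\cdot B)\cdot C\le\zeta_1(D)$. (xi) $L^{(5)}\le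 (D\cap\zeta_1(B)) + (D\cap\zeta_1(C))\le\zeta_1(D)$. (xii) The factor-algebra $L/((D\cap\zeta_1(B)) + (D\cap\zeta_1(C)))$ is nilpotent and $\mathbf{uzl}\bigl(L/((D\cap\zeta_1(B)) + (D\cap\zeta_1(C)))\bigr)\le 3$.
   Context: A left pre-Lie algebra over a field $F$ is an $F$-vector space $L$ with a bilinear product $\cdot$ satisfying $(x\cdot y)\cdot z - x\cdot(y\cdot z) = (y\cdot x)\cdot z - y\cdot(x\cdot z)$ for all $x,y,z\in L$. An ideal of $L$ is a two-sided ideal. For subspaces $U,V$ of $L$, $U\cdot V$ denotes the subspace spanned by all products $u\cdot v$ with $u\in U$, $v\in V$, and $U\le V$ means that $U$ is contained in $V$. For a pre-Lie algebra $A$ (in particular an ideal of $L$ regarded as an algebra in its own right): $A^1 = A$, $A^{n+1} = A\cdot A^n$; $A^{(1)} = A$, $A^{(n+1)} = A^{(n)}\cdot A$. $A$ is abelian if $x\cdot y = 0$ for all $x,y\in A$. The annihilation center is $\zeta_1(A) = \{x\in A \mid x\cdot y = y\cdot x = 0 \text{ for all } y\in A\}$, which is an ideal of $A$. The upper central series of $A$ is given by $\zeta_0(A) = \langle 0\rangle$ and $\zeta_{n+1}(A)/\zeta_n(A) = \zeta_1(A/\zeta_n(A))$. For ideals $Y\le X$ of $A$, the factor $X/Y$ is central in $A$ if $X\cdot A + A\cdot X\le Y$. $A$ is nilpotent if it has a finite series of ideals of $A$ from $\langle 0\rangle$ to $A$ whose successive factors are central in $A$; equivalently $A = \zeta_n(A)$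 for some $n$. $\mathbf{uzl}(A)$ is the length of the upper central series; for nilpotent $A$ it is the least $n\geq 0$ with $\zeta_n(A) = A$. $\langle 0\rangle$ denotes the zero subspace. *)

theory Defs
  imports "HOL-Algebra.Module" "HOL-Algebra.QuotRing"
begin

text \<open>An algebra over \<open>F\<close> is a record of type \<^typ>\<open>('f, 'a) module\<close>; as for the locale
  \<^locale>\<open>algebra\<close>, its \<open>mult\<close> field is the algebra product. The \<open>one\<close> field of the record
  is never constrained.\<close>

locale left_pre_lie_algebra = field F + module F L
  for F :: "('f, 'm) ring_scheme" (structure) and L :: "('f, 'a, 'n) module_scheme" (structure) +
  assumes prod_closed:
      "\<lbrakk>x \<in> carrier L; y \<in> carrier L\<rbrakk> \<Longrightarrow> x \<otimes>\<^bsub>L\<^esub> y \<in> carrier L"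
    and prod_add_left:
      "\<lbrakk>x \<in> carrier L; y \<in> carrier L; z \<in> carrier L\<rbrakk> \<Longrightarrow>
        (x \<oplus>\<^bsub>L\<^esub> y) \<otimes>\<^bsub>L\<^esub> z = (x \<otimes>\<^bsub>L\<^esub> z) \<oplus>\<^bsub>L\<^esub> (y \<otimes>\<^bsub>L\<^esub> z)"
    and prod_add_right:
      "\<lbrakk>x \<in> carrier L; y \<in> carrier L; z \<in> carrier L\<rbrakk> \<Longrightarrow>
        x \<otimes>\<^bsub>L\<^esub> (y \<oplus>\<^bsub>L\<^esub> z) = (x \<otimes>\<^bsub>L\<^esub> y) \<oplus>\<^bsub>L\<^esub> (x \<otimes>\<^bsub>L\<^esub> z)"
    and prod_smult_left:
      "\<lbrakk>a \<in> carrier F; x \<in> carrier L; y \<in> carrier L\<rbrakk> \<Longrightarrow>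
        (a \<odot>\<^bsub>L\<^esub> x) \<otimes>\<^bsub>L\<^esub> y = a \<odot>\<^bsub>L\<^esub> (x \<otimes>\<^bsub>L\<^esub> y)"
    and prod_smult_right:
      "\<lbrakk>a \<in> carrier F; x \<in> carrier L; y \<in> carrier L\<rbrakk> \<Longrightarrow>
        x \<otimes>\<^bsub>L\<^esub> (a \<odot>\<^bsub>L\<^esub> y) = a \<odot>\<^bsub>L\<^esub> (x \<otimes>\<^bsub>L\<^esub> y)"
    and left_symmetric:
      "\<lbrakk>x \<in> carrier L; y \<in> carrier L; z \<in> carrier L\<rbrakk> \<Longrightarrow>
        ((x \<otimes>\<^bsub>L\<^esub> y) \<otimes>\<^bsub>L\<^esub> z) \<ominus>\<^bsub>L\<^esub> (x \<otimes>\<^bsub>L\<^esub> (y \<otimes>\<^bsub>L\<^esub> z)) =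
        ((y \<otimes>\<^bsub>L\<^esub> x) \<otimes>\<^bsub>L\<^esub> z) \<ominus>\<^bsub>L\<^esub> (y \<otimes>\<^bsub>L\<^esub> (x \<otimes>\<^bsub>L\<^esub> z))"

definition alg_ideal ::
    "('f, 'm) ring_scheme \<Rightarrow> ('f, 'a, 'n) module_scheme \<Rightarrow> 'a set \<Rightarrow> bool" where
  "alg_ideal F A I \<longleftrightarrow> submodule I F A \<and>
     (\<forall>x \<in> carrier A. \<forall>u \<in> I. x \<otimes>\<^bsub>A\<^esub> u \<in> I \<and> u \<otimes>\<^bsub>A\<^esub> x \<in> I)"

definition prod_span ::
    "('f, 'm) ring_scheme \<Rightarrow> ('f, 'a, 'n) module_scheme \<Rightarrow> 'a set \<Rightarrow> 'a set \<Rightarrow> 'a set" where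
  "prod_span F A U V =
     \<Inter>{W. submodule W F A \<and> {u \<otimes>\<^bsub>A\<^esub> v |u v. u \<in> U \<and> v \<in> V} \<subseteq> W}"

abbreviation prod_span_infix ::
    "'a set \<Rightarrow> ('f, 'm) ring_scheme \<Rightarrow> ('f, 'a, 'n) module_scheme \<Rightarrow> 'a set \<Rightarrow> 'a set"
    (\<open>_ \<bullet>\<^bsub>_,_\<^esub> _\<close> [71, 0, 0, 71] 70) where
  "U \<bullet>\<^bsub>F,A\<^esub> V \<equiv> prod_span F A U V"

text \<open>The powers $A^n$ and $A^{(n)}$ are indexed from $1$; the value at $0$ is a dummy.\<close>

fun left_power :: "('f, 'm) ring_scheme \<Rightarrow> ('f, 'a, 'n) module_scheme \<Rightarrow> nat \<Rightarrow> 'a set" where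
  "left_power F A 0 = carrier A"
| "left_power F A (Suc 0) = carrier A"
| "left_power F A (Suc (Suc n)) = carrier A \<bullet>\<^bsub>F,A\<^esub> left_power F A (Suc n)"

fun right_power :: "('f, 'm) ring_scheme \<Rightarrow> ('f, 'a, 'n) module_scheme \<Rightarrow> nat \<Rightarrow> 'a set" where
  "right_power F A 0 = carrier A"
| "right_power F A (Suc 0) = carrier A"
| "right_power F A (Suc (Suc n)) = right_power F A (Suc n) \<bullet>\<^bsub>F,A\<^esub> carrier A"

definition abelian_alg :: "('f, 'a, 'n) module_scheme \<Rightarrow> bool" where
  "abelian_alg A \<longleftrightarrow> (\<forall>x \<in> carrier A. \<forall>y \<in> carrier A. x \<otimes>\<^bsub>A\<^esub> y = \<zero>\<^bsub>A\<^esub>)"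

definition ann_center :: "('f, 'a, 'n) module_scheme \<Rightarrow> 'a set" where
  "ann_center A =
     {x \<in> carrier A. \<forall>y \<in> carrier A. x \<otimes>\<^bsub>A\<^esub> y = \<zero>\<^bsub>A\<^esub> \<and> y \<otimes>\<^bsub>A\<^esub> x = \<zero>\<^bsub>A\<^esub>}"

text \<open>\<^const>\<open>FactRing\<close> discards the scalar multiplication, so the factor algebra is written
  out with the same components and the induced scalar multiplication added.\<close>

definition factor_alg ::
    "('f, 'a, 'n) module_scheme \<Rightarrow> 'a set \<Rightarrow> ('f, 'a set) module" where
  "factor_alg A I =
     \<lparr>carrier = a_rcosets\<^bsub>A\<^esub> I, monoid.mult = rcoset_mult A I,
      one = I +>\<^bsub>A\<^esub> \<one>\<^bsub>A\<^esub>, zero = I, add = set_add A,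
      smult = (\<lambda>a U. \<Union>x \<in> U. I +>\<^bsub>A\<^esub> (a \<odot>\<^bsub>A\<^esub> x))\<rparr>"

text \<open>$\zeta_{n+1}(A)$ is the full preimage in $A$ of $\zeta_1(A/\zeta_n(A))$.\<close>

primrec upper_central :: "('f, 'a, 'n) module_scheme \<Rightarrow> nat \<Rightarrow> 'a set" where
  "upper_central A 0 = {\<zero>\<^bsub>A\<^esub>}"
| "upper_central A (Suc n) =
     {x \<in> carrier A. upper_central A n +>\<^bsub>A\<^esub> x \<in> ann_center (factor_alg A (upper_central A n))}"

definition central_factor ::
    "('f, 'm) ring_scheme \<Rightarrow> ('f, 'a, 'n) module_scheme \<Rightarrow> 'a set \<Rightarrow> 'a set \<Rightarrow> bool" where
  "central_factor F A X Y \<longleftrightarrow>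
     (X \<bullet>\<^bsub>F,A\<^esub> carrier A) <+>\<^bsub>A\<^esub> (carrier A \<bullet>\<^bsub>F,A\<^esub> X) \<subseteq> Y"

definition nilpotent_alg ::
    "('f, 'm) ring_scheme \<Rightarrow> ('f, 'a, 'n) module_scheme \<Rightarrow> bool" where
  "nilpotent_alg F A \<longleftrightarrow>
     (\<exists>(Z :: nat \<Rightarrow> 'a set) n. Z 0 = {\<zero>\<^bsub>A\<^esub>} \<and> Z n = carrier A \<and>
        (\<forall>i \<le> n. alg_ideal F A (Z i)) \<and>
        (\<forall>i < n. Z i \<subseteq> Z (Suc i) \<and> central_factor F A (Z (Suc i)) (Z i)))"

text \<open>The length of the upper central series. It is meaningful only for nilpotent algebras,
  for which the upper central series reaches the whole algebra.\<close>

definition uzl :: "('f, 'a, 'n) module_scheme \<Rightarrow> nat" where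
  "uzl A = (LEAST n. upper_central A n = carrier A)"

end

theory Submission
  imports Defs
begin

text \<open>Elements of \<open>B \<bullet> D\<close> and \<open>D \<bullet> B\<close> lie in \<open>D \<inter> \<zeta>\<^sub>1(B)\<close>, and likewise for \<open>C\<close>, so that \<open>L \<bullet> D\<close> and
  \<open>D \<bullet> L\<close> are contained in the subspace \<open>K\<close> of the theorem, and any subspace between \<open>K\<close> and
  \<open>D\<close> is an ideal. Left symmetry is used only once, to show that \<open>b(cd)\<close> annihilates \<open>C\<close>.
  As \<open>B\<close> and \<open>C\<close> multiply each other into \<open>D\<close>, the set \<open>E\<close> of elements whose products with
  \<open>L\<close> lie in \<open>D\<close> contains \<open>L \<bullet> L\<close>; hence three factors always reach \<open>D\<close>, and
  \<open>K \<subseteq> D \<subseteq> E \<subseteq> L\<close> is a central series of length three modulo \<open>K\<close>.\<close>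

section \<open>Bilinear algebras: subspaces and their sums\<close>

text \<open>Ideals and factor algebras are used below only through their bilinear structure, so this
  is the locale that is instantiated at them; left symmetry is kept for L itself.\<close>

locale bilinear_algebra = module F A
  for F :: "('f, 'm) ring_scheme" and A :: "('f, 'a, 'n) module_scheme" (structure) +
  assumes prod_closed [simp, intro]:
      "\<lbrakk>x \<in> carrier A; y \<in> carrier A\<rbrakk> \<Longrightarrow> x \<otimes> y \<in> carrier A"
    and prod_add_left:
      "\<lbrakk>x \<in> carrier A; y \<in> carrier A; z \<in> carrier A\<rbrakk> \<Longrightarrow> (x \<oplus> y) \<otimes> z = x \<otimes> z \<oplus> y \<otimes> z"
    and prod_add_right:
      "\<lbrakk>x \<in> carrier A; y \<in> carrier A; z \<in> carrier A\<rbrakk> \<Longrightarrow> x \<otimes> (y \<oplus> z) = x \<otimes> y \<oplus> x \<otimes> z"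
    and prod_smult_left:
      "\<lbrakk>a \<in> carrier F; x \<in> carrier A; y \<in> carrier A\<rbrakk> \<Longrightarrow> (a \<odot> x) \<otimes> y = a \<odot> (x \<otimes> y)"
    and prod_smult_right:
      "\<lbrakk>a \<in> carrier F; x \<in> carrier A; y \<in> carrier A\<rbrakk> \<Longrightarrow> x \<otimes> (a \<odot> y) = a \<odot> (x \<otimes> y)"

sublocale left_pre_lie_algebra \<subseteq> bilinear_algebra F L
  by (unfold_locales; fact prod_closed prod_add_left prod_add_right prod_smult_left prod_smult_right)

context bilinear_algebra
begin

lemma prod_zero_left [simp]:
  assumes "x \<in> carrier A" shows "\<zero> \<otimes> x = \<zero>"
  using prod_smult_left[of "\<zero>\<^bsub>F\<^esub>" \<zero> x] assms by simp

lemma prod_zero_right [simp]: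
  assumes "x \<in> carrier A" shows "x \<otimes> \<zero> = \<zero>"
  using prod_smult_right[of "\<zero>\<^bsub>F\<^esub>" x \<zero>] assms by simp

lemma submodule_zero: "submodule U F A \<Longrightarrow> \<zero> \<in> U"
  using subgroup.one_closed[OF submodule.axioms(1)] by fastforce

text \<open>Closure under negation is scalar multiplication by \<open>- 1\<close>.\<close>
lemma submoduleI':
  assumes "U \<subseteq> carrier A" "\<zero> \<in> U"
    and "\<And>x y. \<lbrakk>x \<in> U; y \<in> U\<rbrakk> \<Longrightarrow> x \<oplus> y \<in> U"
    and smult: "\<And>a x. \<lbrakk>a \<in> carrier F; x \<in> U\<rbrakk> \<Longrightarrow> a \<odot> x \<in> U"
  shows "submodule U F A"
proof (rule submoduleI)
  fix x assume "x \<in> U"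
  then have "\<ominus> x = (\<ominus>\<^bsub>F\<^esub> \<one>\<^bsub>F\<^esub>) \<odot> x"
    using assms(1) by (subst smult_l_minus) auto
  with \<open>x \<in> U\<close> show "\<ominus> x \<in> U" by (simp add: smult)
qed (use assms in auto)

lemma submodule_Int:
  assumes "submodule U F A" "submodule V F A" shows "submodule (U \<inter> V) F A"
  by (rule submoduleI') (use assms submodule_zero submoduleE(1,4,5) in auto)

lemma zero_submodule: "submodule {\<zero>} F A"
  by (rule submoduleI') auto

lemma set_add_iff: "x \<in> U <+>\<^bsub>A\<^esub> V \<longleftrightarrow> (\<exists>u\<in>U. \<exists>v\<in>V. x = u \<oplus> v)"
  by (auto simp: set_add_def')

lemma set_addI: "\<lbrakk>u \<in> U; v \<in> V\<rbrakk> \<Longrightarrow> u \<oplus> v \<in> U <+>\<^bsub>A\<^esub> V"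
  by (auto simp: set_add_iff)

lemma submodule_set_add:
  assumes "submodule U F A" "submodule V F A" shows "submodule (U <+>\<^bsub>A\<^esub> V) F A"
proof (rule submoduleI')
  note UV = submoduleE[OF assms(1)] submoduleE[OF assms(2)]
  show "U <+>\<^bsub>A\<^esub> V \<subseteq> carrier A" using UV by (intro set_add_closed)
  show "\<zero> \<in> U <+>\<^bsub>A\<^esub> V"
    using assms[THEN submodule_zero] by (force simp: set_add_iff)
  fix x assume "x \<in> U <+>\<^bsub>A\<^esub> V"
  then obtain u v where x: "u \<in> U" "v \<in> V" "x = u \<oplus> v" by (auto simp: set_add_iff)
  then have c: "u \<in> carrier A" "v \<in> carrier A" using UV by auto
  { fix y assume "y \<in> U <+>\<^bsub>A\<^esub> V"
    then obtain u' v' where y: "u' \<in> U" "v' \<in> V" "y = u' \<oplus> v'" by (auto simp: set_add_iff)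
    then have "u' \<in> carrier A" "v' \<in> carrier A" using UV by auto
    with c have "x \<oplus> y = (u \<oplus> u') \<oplus> (v \<oplus> v')" by (simp add: x y M.a_ac)
    with x y show "x \<oplus> y \<in> U <+>\<^bsub>A\<^esub> V" using UV(5,11) unfolding set_add_iff by blast }
  { fix a assume "a \<in> carrier F"
    moreover from this c have "a \<odot> x = a \<odot> u \<oplus> a \<odot> v" by (simp add: x smult_r_distr)
    ultimately show "a \<odot> x \<in> U <+>\<^bsub>A\<^esub> V" using x UV(4,10) unfolding set_add_iff by blast }
qed

lemma set_add_least:
  "\<lbrakk>submodule W F A; U \<subseteq> W; V \<subseteq> W\<rbrakk> \<Longrightarrow> U <+>\<^bsub>A\<^esub> V \<subseteq> W"
  using submoduleE(5) by (fastforce simp: set_add_iff)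

lemma set_add_upper1: "\<lbrakk>U \<subseteq> carrier A; submodule V F A\<rbrakk> \<Longrightarrow> U \<subseteq> U <+>\<^bsub>A\<^esub> V"
  using submodule_zero[of V] by (force simp: set_add_iff)

lemma set_add_upper2: "\<lbrakk>submodule U F A; V \<subseteq> carrier A\<rbrakk> \<Longrightarrow> V \<subseteq> U <+>\<^bsub>A\<^esub> V"
  using submodule_zero[of U] by (force simp: set_add_iff)

lemma set_add_commute: "\<lbrakk>U \<subseteq> carrier A; V \<subseteq> carrier A\<rbrakk> \<Longrightarrow> U <+>\<^bsub>A\<^esub> V = V <+>\<^bsub>A\<^esub> U"
  by (auto simp: set_add_iff) (metis M.a_comm subsetD)+

section \<open>Spans of products and residuals\<close>

lemma prod_spanI: "\<lbrakk>u \<in> U; v \<in> V\<rbrakk> \<Longrightarrow> u \<otimes> v \<in> U \<bullet>\<^bsub>F,A\<^esub> V"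
  by (auto simp: prod_span_def)

lemma prod_span_least:
  "\<lbrakk>submodule W F A; \<And>u v. \<lbrakk>u \<in> U; v \<in> V\<rbrakk> \<Longrightarrow> u \<otimes> v \<in> W\<rbrakk> \<Longrightarrow> U \<bullet>\<^bsub>F,A\<^esub> V \<subseteq> W"
  by (auto simp: prod_span_def)

lemma prod_span_subset_carrier:
  "\<lbrakk>U \<subseteq> carrier A; V \<subseteq> carrier A\<rbrakk> \<Longrightarrow> U \<bullet>\<^bsub>F,A\<^esub> V \<subseteq> carrier A"
  by (rule prod_span_least[OF carrier_is_submodule]) auto

lemma submodule_prod_span:
  assumes "U \<subseteq> carrier A" "V \<subseteq> carrier A" shows "submodule (U \<bullet>\<^bsub>F,A\<^esub> V) F A"
  by (rule submoduleI')
    (use prod_span_subset_carrier[OF assms] submodule_zero submoduleE(4,5)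
      in \<open>auto simp: prod_span_def\<close>)

lemma prod_span_mono:
  assumes "U \<subseteq> U'" "V \<subseteq> V'" "U' \<subseteq> carrier A" "V' \<subseteq> carrier A"
  shows "U \<bullet>\<^bsub>F,A\<^esub> V \<subseteq> U' \<bullet>\<^bsub>F,A\<^esub> V'"
  by (rule prod_span_least[OF submodule_prod_span]) (use assms in \<open>auto intro!: prod_spanI\<close>)

text \<open>By bilinearity the condition on \<open>x\<close> is linear. Residuals carry claims from
  generators to spans; with \<open>W\<close> zero, a term of the central series, or
  \<open>D\<close>, they also show that annihilators, the next term, and \<open>E\<close> are
  subspaces.\<close>

lemma submodule_left_residual:
  assumes "U \<subseteq> carrier A" "submodule W F A"
  shows "submodule {x \<in> carrier A. \<forall>u\<in>U. u \<otimes> x \<in> W} F A"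
  by (rule submoduleI')
    (use assms submodule_zero submoduleE(4,5)[OF assms(2)]
      in \<open>auto simp: subset_eq prod_add_right prod_smult_right\<close>)

lemma submodule_right_residual:
  assumes "U \<subseteq> carrier A" "submodule W F A"
  shows "submodule {x \<in> carrier A. \<forall>u\<in>U. x \<otimes> u \<in> W} F A"
  by (rule submoduleI')
    (use assms submodule_zero submoduleE(4,5)[OF assms(2)]
      in \<open>auto simp: subset_eq prod_add_left prod_smult_left\<close>)

text \<open>The products \<open>v \<otimes> x\<close> lie in the left residual of \<open>W\<close>
  by \<open>U\<close>, which is a subspace and so contains their span. Triple products thus need
  checking on elements only.\<close>

lemma prod_span_nested_left:
  assumes "submodule W F A" "U \<subseteq> carrier A" "V \<subseteq> carrier A" "X \<subseteq> carrier A"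
    and "\<And>u v x. \<lbrakk>u \<in> U; v \<in> V; x \<in> X\<rbrakk> \<Longrightarrow> u \<otimes> (v \<otimes> x) \<in> W"
  shows "U \<bullet>\<^bsub>F,A\<^esub> (V \<bullet>\<^bsub>F,A\<^esub> X) \<subseteq> W"
proof -
  have "V \<bullet>\<^bsub>F,A\<^esub> X \<subseteq> {x \<in> carrier A. \<forall>u\<in>U. u \<otimes> x \<in> W}"
    by (rule prod_span_least[OF submodule_left_residual]) (use assms in auto)
  then show ?thesis by (intro prod_span_least[OF assms(1)]) auto
qed

lemma prod_span_nested_right:
  assumes "submodule W F A" "U \<subseteq> carrier A" "V \<subseteq> carrier A" "X \<subseteq> carrier A"
    and "\<And>u v x. \<lbrakk>u \<in> U; v \<in> V; x \<in> X\<rbrakk> \<Longrightarrow> (u \<otimes> v) \<otimes> x \<in> W"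
  shows "(U \<bullet>\<^bsub>F,A\<^esub> V) \<bullet>\<^bsub>F,A\<^esub> X \<subseteq> W"
proof -
  have "U \<bullet>\<^bsub>F,A\<^esub> V \<subseteq> {y \<in> carrier A. \<forall>x\<in>X. y \<otimes> x \<in> W}"
    by (rule prod_span_least[OF submodule_right_residual]) (use assms in auto)
  then show ?thesis by (intro prod_span_least[OF assms(1)]) auto
qed

section \<open>Ideals, also as algebras in their own right\<close>

lemma alg_idealD:
  assumes "alg_ideal F A I"
  shows "submodule I F A" "I \<subseteq> carrier A"
    and "\<And>x u. \<lbrakk>x \<in> carrier A; u \<in> I\<rbrakk> \<Longrightarrow> x \<otimes> u \<in> I"
    and "\<And>x u. \<lbrakk>x \<in> carrier A; u \<in> I\<rbrakk> \<Longrightarrow> u \<otimes> x \<in> I"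
  using assms submoduleE(1) unfolding alg_ideal_def by blast+

lemma alg_ideal_Int:
  "\<lbrakk>alg_ideal F A I; alg_ideal F A J\<rbrakk> \<Longrightarrow> alg_ideal F A (I \<inter> J)"
  by (simp add: alg_ideal_def submodule_Int)

text \<open>Makes the general facts on upper central series available for the algebras B and
  C.\<close>

lemma bilinear_algebra_ideal:
  assumes "alg_ideal F A I" shows "bilinear_algebra F (A\<lparr>carrier := I\<rparr>)"
proof -
  note I = alg_idealD[OF assms]
  have [simp]: "x \<in> carrier A" if "x \<in> I" for x using that I by auto
  interpret I: module F "A\<lparr>carrier := I\<rparr>"
    by (rule submodule.submodule_is_module[OF I(1) module_axioms])
  show ?thesis
    by unfold_locales
      (use I in \<open>auto simp: prod_add_left prod_add_right prod_smult_left prod_smult_right\<close>)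
qed

lemma ann_center_submodule:
  assumes "submodule U F A" shows "submodule (ann_center (A\<lparr>carrier := U\<rparr>)) F A"
proof -
  have U: "U \<subseteq> carrier A" using assms submoduleE by blast
  \<comment> \<open>Annihilating \<open>U\<close> from one side is membership in a residual of the
    zero subspace.\<close>
  have "ann_center (A\<lparr>carrier := U\<rparr>) =
      U \<inter> ({x \<in> carrier A. \<forall>u\<in>U. u \<otimes> x \<in> {\<zero>}} \<inter> {x \<in> carrier A. \<forall>u\<in>U. x \<otimes> u \<in> {\<zero>}})"
    using U by (auto simp: ann_center_def)
  then show ?thesis
    by (simp only: submodule_Int assms U zero_submodule
        submodule_left_residual submodule_right_residual)
qed

end

section \<open>Factor algebras\<close>

locale bilinear_algebra_ideal = bilinear_algebra +
  fixes I assumes ideal: "alg_ideal F A I"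

sublocale bilinear_algebra_ideal \<subseteq> abelian_subgroup I A
  by (rule abelian_subgroupI3[OF additive_subgroup.intro[OF submodule.axioms(1)]])
    (use alg_idealD[OF ideal] M.abelian_group_axioms in auto)

context bilinear_algebra_ideal
begin

lemma coset_eq_ideal_iff: "x \<in> carrier A \<Longrightarrow> I +> x = I \<longleftrightarrow> x \<in> I"
  using a_rcos_const a_rcos_self by blast

text \<open>\<open>rcoset_mult\<close> is a union over all representatives, so all of them must give
  one coset: \<open>(h \<oplus> x) \<otimes> (k \<oplus> y)\<close> differs from
  \<open>x \<otimes> y\<close> by \<open>h \<otimes> (k \<oplus> y) \<oplus> x \<otimes> k\<close>,
  which lies in the ideal.\<close>

lemma rcoset_mult_coset:
  assumes "x \<in> carrier A" "y \<in> carrier A"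
  shows "rcoset_mult A I (I +> x) (I +> y) = I +> x \<otimes> y"
proof -
  note I = alg_idealD[OF ideal]
  have "I +> x' \<otimes> y' = I +> x \<otimes> y" if cosets: "x' \<in> I +> x" "y' \<in> I +> y" for x' y'
  proof -
    obtain h k where hk: "h \<in> I" "k \<in> I" "x' = h \<oplus> x" "y' = k \<oplus> y"
      using cosets by (auto simp: a_r_coset_def')
    then have "x' \<otimes> y' = (h \<otimes> (k \<oplus> y) \<oplus> x \<otimes> k) \<oplus> x \<otimes> y"
      using assms by (simp add: prod_add_left prod_add_right M.a_ac)
    moreover have "h \<otimes> (k \<oplus> y) \<oplus> x \<otimes> k \<in> I" using hk assms I by auto
    ultimately have "x' \<otimes> y' \<in> I +> x \<otimes> y" by (auto simp: a_r_coset_def')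
    then show ?thesis using assms by (metis a_repr_independence' prod_closed)
  qed
  then show ?thesis
    unfolding rcoset_mult_def using assms a_rcos_self by blast
qed

text \<open>The union in the scalar multiplication of \<open>factor_alg\<close> collapses in the
  same way, since \<open>a \<odot> h\<close> stays in \<open>I\<close>.\<close>

lemma smult_coset:
  assumes "a \<in> carrier F" "x \<in> carrier A"
  shows "(\<Union>x' \<in> I +> x. I +> a \<odot> x') = I +> a \<odot> x"
proof -
  note I = alg_idealD[OF ideal]
  have "I +> a \<odot> x' = I +> a \<odot> x" if cosets: "x' \<in> I +> x" for x'
  proof -
    obtain h where h: "h \<in> I" "x' = h \<oplus> x"
      using cosets by (auto simp: a_r_coset_def')
    then have "a \<odot> x' = a \<odot> h \<oplus> a \<odot> x" using assms by (simp add: smult_r_distr)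
    then have "a \<odot> x' \<in> I +> a \<odot> x"
      using h submoduleE(4)[OF I(1)] assms by (auto simp: a_r_coset_def')
    then show ?thesis using assms by (metis a_repr_independence' smult_closed)
  qed
  then show ?thesis using assms a_rcos_self by blast
qed

lemma carrier_factor: "carrier (factor_alg A I) = (\<lambda>x. I +> x) ` carrier A"
  by (auto simp: factor_alg_def A_RCOSETS_def')

lemma factor_simps [simp]:
  "x \<in> carrier A \<Longrightarrow> I +> x \<in> carrier (factor_alg A I)"
  "\<zero>\<^bsub>factor_alg A I\<^esub> = I"
  "\<lbrakk>x \<in> carrier A; y \<in> carrier A\<rbrakk> \<Longrightarrow> (I +> x) \<otimes>\<^bsub>factor_alg A I\<^esub> (I +> y) = I +> x \<otimes> y"
  "\<lbrakk>x \<in> carrier A; y \<in> carrier A\<rbrakk> \<Longrightarrow> (I +> x) \<oplus>\<^bsub>factor_alg A I\<^esub> (I +> y) = I +> (x \<oplus> y)"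
  "\<lbrakk>a \<in> carrier F; x \<in> carrier A\<rbrakk> \<Longrightarrow> a \<odot>\<^bsub>factor_alg A I\<^esub> (I +> x) = I +> a \<odot> x"
  by (auto simp: carrier_factor) (auto simp: factor_alg_def rcoset_mult_coset a_rcos_sum smult_coset)

text \<open>By \<open>factor_simps\<close> all operations are computed on representatives, so each
  law is inherited from \<open>A\<close>.\<close>

lemma bilinear_algebra_factor: "bilinear_algebra F (factor_alg A I)"
proof -
  let ?Q = "factor_alg A I"
  have I: "I = I +> \<zero>" by (simp add: a_subset)
  have "abelian_group ?Q"
  proof (rule abelian_groupI)
    show "\<zero>\<^bsub>?Q\<^esub> \<in> carrier ?Q" by (subst factor_simps, subst I) simp
    fix X assume "X \<in> carrier ?Q"
    then obtain x where x: "x \<in> carrier A" "X = I +> x" by (auto simp: carrier_factor)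
    show "\<zero>\<^bsub>?Q\<^esub> \<oplus>\<^bsub>?Q\<^esub> X = X"
      using x factor_simps(4)[of \<zero> x] by (simp add: a_subset)
    show "\<exists>Y\<in>carrier ?Q. Y \<oplus>\<^bsub>?Q\<^esub> X = \<zero>\<^bsub>?Q\<^esub>"
      using x by (intro bexI[of _ "I +> \<ominus> x"]) (auto simp: M.l_neg a_subset)
  qed (auto simp: carrier_factor M.a_ac)
  then interpret Q: abelian_group ?Q .
  show ?thesis
    by unfold_locales
      (auto simp: carrier_factor smult_l_distr smult_r_distr smult_assoc1
        prod_add_left prod_add_right prod_smult_left prod_smult_right)
qed

text \<open>A coset is the zero of the factor exactly if its representative lies in
  \<open>I\<close>; this brings the central series back from cosets to elements of
  \<open>A\<close>.\<close>

lemma coset_in_ann_center_iff: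
  assumes "x \<in> carrier A"
  shows "I +> x \<in> ann_center (factor_alg A I) \<longleftrightarrow> (\<forall>y\<in>carrier A. x \<otimes> y \<in> I \<and> y \<otimes> x \<in> I)"
  using assms by (simp add: ann_center_def carrier_factor coset_eq_ideal_iff)

end

section \<open>The upper central series\<close>

context bilinear_algebra
begin

text \<open>The two claims feed each other: the definition by cosets unfolds to a condition on
  elements only once the previous term is an ideal, and the unfolded form shows that the next term
  is an ideal.\<close>

lemma
  shows upper_central_ideal: "alg_ideal F A (upper_central A n)"
    and upper_central_Suc: "upper_central A (Suc n) =
      {x \<in> carrier A. \<forall>y\<in>carrier A. x \<otimes> y \<in> upper_central A n \<and> y \<otimes> x \<in> upper_central A n}"
    (is "_ = ?S (upper_central A n)")
proof -
  have step: "upper_central A (Suc n) = ?S (upper_central A n)"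
    if "alg_ideal F A (upper_central A n)" for n
  proof -
    interpret bilinear_algebra_ideal F A "upper_central A n"
      by unfold_locales (rule that)
    show ?thesis by (auto simp: coset_in_ann_center_iff)
  qed
  have ideal: "alg_ideal F A (upper_central A n)" for n
  proof (induction n)
    case 0
    show ?case by (simp add: alg_ideal_def zero_submodule)
  next
    case (Suc n)
    note Z = alg_idealD[OF Suc.IH]
    have "?S (upper_central A n) = {x \<in> carrier A. \<forall>u\<in>carrier A. u \<otimes> x \<in> upper_central A n} \<inter>
        {x \<in> carrier A. \<forall>u\<in>carrier A. x \<otimes> u \<in> upper_central A n}" by auto
    then have "submodule (?S (upper_central A n)) F A"
      by (simp only: submodule_Int submodule_left_residual submodule_right_residual Z(1) order_refl)
    \<comment> \<open>Products with elements of the next term fall into the current term, and this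
      is contained in the next one because it is an ideal.\<close>
    then show ?case
      unfolding step[OF Suc.IH] alg_ideal_def using Z by blast
  qed
  show "alg_ideal F A (upper_central A n)" by (rule ideal)
  show "upper_central A (Suc n) = ?S (upper_central A n)" by (rule step[OF ideal])
qed

lemma upper_central_1: "upper_central A 1 = ann_center A"
  by (simp only: One_nat_def upper_central_Suc) (auto simp: ann_center_def)

text \<open>The upper central series itself is the required central series.\<close>

lemma nilpotent_algI:
  assumes "upper_central A n = carrier A" shows "nilpotent_alg F A"
  unfolding nilpotent_alg_def
proof (intro exI[of _ "upper_central A"] exI[of _ n] conjI allI impI)
  fix i
  note Z = alg_idealD[OF upper_central_ideal[of i]]
  show "alg_ideal F A (upper_central A i)" by (rule upper_central_ideal)
  show "upper_central A i \<subseteq> upper_central A (Suc i)"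
    using Z unfolding upper_central_Suc by blast
  have "x \<otimes> y \<in> upper_central A i \<and> y \<otimes> x \<in> upper_central A i"
    if "x \<in> upper_central A (Suc i)" "y \<in> carrier A" for x y
    using that unfolding upper_central_Suc by blast
  then show "central_factor F A (upper_central A (Suc i)) (upper_central A i)"
    unfolding central_factor_def by (intro set_add_least prod_span_least Z(1)) blast+
qed (simp_all add: assms)

lemma submodule_minus: "\<lbrakk>submodule U F A; x \<in> U; y \<in> U\<rbrakk> \<Longrightarrow> x \<ominus> y \<in> U"
  unfolding a_minus_def by (intro submoduleE(3,5))

lemma minus_minus_cancel: "\<lbrakk>x \<in> carrier A; y \<in> carrier A\<rbrakk> \<Longrightarrow> x \<ominus> (x \<ominus> y) = y"
  by (simp add: a_minus_def M.minus_add M.a_assoc[symmetric] M.r_neg)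

text \<open>Extracts from the assumptions on the second center the form in which they are used:
  products within the ideal land in its annihilation center.\<close>

lemma upper_central_2_prod:
  assumes "alg_ideal F A I" "I = upper_central (A\<lparr>carrier := I\<rparr>) 2" "x \<in> I" "y \<in> I"
  shows "x \<otimes> y \<in> ann_center (A\<lparr>carrier := I\<rparr>)"
proof -
  interpret I: bilinear_algebra F "A\<lparr>carrier := I\<rparr>"
    by (rule bilinear_algebra_ideal[OF assms(1)])
  have "x \<in> upper_central (A\<lparr>carrier := I\<rparr>) (Suc 1)"
    using assms(2,3) by (simp only: Suc_1)
  then show ?thesis
    using assms(4) unfolding I.upper_central_Suc I.upper_central_1 by simp
qed

end

section \<open>Two ideals with sum L\<close>

text \<open>\<open>BB\<close> and \<open>CC\<close> stand for the conditions on the second centers.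
  The assumptions are symmetric in \<open>B\<close> and \<open>C\<close>, which \<open>swap\<close>
  exploits.\<close>

locale two_step_ideal_sum = left_pre_lie_algebra F L
  for F :: "('f, 'm) ring_scheme" and L :: "('f, 'a, 'n) module_scheme" (structure) +
  fixes B C :: "'a set"
  assumes B_ideal: "alg_ideal F L B"
    and C_ideal: "alg_ideal F L C"
    and carrier_sum: "carrier L = B <+>\<^bsub>L\<^esub> C"
    and BB: "\<lbrakk>x \<in> B; y \<in> B\<rbrakk> \<Longrightarrow> x \<otimes> y \<in> ann_center (L\<lparr>carrier := B\<rparr>)"
    and CC: "\<lbrakk>x \<in> C; y \<in> C\<rbrakk> \<Longrightarrow> x \<otimes> y \<in> ann_center (L\<lparr>carrier := C\<rparr>)"
begin

abbreviation zeta :: "'a set \<Rightarrow> 'a set" where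
  "zeta U \<equiv> ann_center (L\<lparr>carrier := U\<rparr>)"

abbreviation D :: "'a set" where "D \<equiv> B \<inter> C"

abbreviation K :: "'a set" where "K \<equiv> (D \<inter> zeta B) <+>\<^bsub>L\<^esub> (D \<inter> zeta C)"

lemma zeta_iff: "x \<in> zeta U \<longleftrightarrow> x \<in> U \<and> (\<forall>y\<in>U. x \<otimes> y = \<zero> \<and> y \<otimes> x = \<zero>)"
  by (simp add: ann_center_def)

lemma carrierE:
  assumes "x \<in> carrier L" obtains b c where "b \<in> B" "c \<in> C" "x = b \<oplus> c"
  using assms carrier_sum by (auto simp: set_add_iff)

lemmas B_sub = alg_idealD(2)[OF B_ideal] and C_sub = alg_idealD(2)[OF C_ideal]

lemma B_carrier: "x \<in> B \<Longrightarrow> x \<in> carrier L" and C_carrier: "x \<in> C \<Longrightarrow> x \<in> carrier L"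
  using B_sub C_sub by auto

lemma D_ideal: "alg_ideal F L D"
  by (rule alg_ideal_Int[OF B_ideal C_ideal])

lemma D_sub: "D \<subseteq> carrier L"
  using B_sub by blast

lemma BC: "\<lbrakk>b \<in> B; c \<in> C\<rbrakk> \<Longrightarrow> b \<otimes> c \<in> D" and CB: "\<lbrakk>b \<in> B; c \<in> C\<rbrakk> \<Longrightarrow> c \<otimes> b \<in> D"
  by (intro IntI alg_idealD(3,4)[OF B_ideal] alg_idealD(3,4)[OF C_ideal] B_carrier C_carrier; assumption)+

lemma submodules:
  "submodule B F L" "submodule C F L" "submodule D F L" "submodule (zeta B) F L"
  "submodule (zeta C) F L" "submodule (zeta D) F L" "submodule (D \<inter> zeta B) F L"
  "submodule (D \<inter> zeta C) F L" "submodule K F L" "submodule (zeta B \<inter> zeta C) F L"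
  by (intro submodule_set_add submodule_Int ann_center_submodule
      alg_idealD(1)[OF B_ideal] alg_idealD(1)[OF C_ideal])+

lemma zeta_B_D: "D \<inter> zeta B \<subseteq> K" and zeta_C_D: "D \<inter> zeta C \<subseteq> K"
  using D_sub by (intro set_add_upper1 set_add_upper2 submodules; blast)+

lemma swap: "two_step_ideal_sum F L C B"
  by unfold_locales
    (use B_ideal C_ideal carrier_sum BB CC set_add_commute[OF B_sub C_sub] in auto)

text \<open>Every element of \<open>L\<close> is some \<open>b \<oplus> c\<close>, and
  \<open>x\<close> annihilates both summands.\<close>

lemma inter_zeta: "zeta B \<inter> zeta C \<subseteq> ann_center L"
proof
  fix x assume x: "x \<in> zeta B \<inter> zeta C"
  then have xL: "x \<in> carrier L" by (auto simp: zeta_iff B_carrier)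
  moreover have "x \<otimes> y = \<zero> \<and> y \<otimes> x = \<zero>" if "y \<in> carrier L" for y
  proof -
    obtain b c where "b \<in> B" "c \<in> C" "y = b \<oplus> c" using \<open>y \<in> carrier L\<close> by (rule carrierE)
    then show ?thesis
      using x xL by (simp add: zeta_iff B_carrier C_carrier prod_add_left prod_add_right)
  qed
  ultimately show "x \<in> ann_center L" by (simp add: ann_center_def)
qed

text \<open>Left symmetry gives $b(cd) = (bc)d - ((cb)d - c(bd))$, and each term on the right is a
  product of two elements of \<open>C\<close>.\<close>
lemma B_CD_elem:
  assumes "b \<in> B" "c \<in> C" "d \<in> D" shows "b \<otimes> (c \<otimes> d) \<in> zeta B \<inter> zeta C"
proof
  note L = assms(1)[THEN B_carrier] assms(2)[THEN C_carrier]
  have d: "d \<in> carrier L" "d \<in> B" "d \<in> C" using assms D_sub by auto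
  have "c \<otimes> d \<in> D" "b \<otimes> d \<in> D" using alg_idealD(3)[OF D_ideal] L assms(3) by auto
  then show "b \<otimes> (c \<otimes> d) \<in> zeta B" using assms BB by blast
  have "b \<otimes> (c \<otimes> d) = (b \<otimes> c) \<otimes> d \<ominus> ((b \<otimes> c) \<otimes> d \<ominus> b \<otimes> (c \<otimes> d))"
    using L d by (intro minus_minus_cancel[symmetric]) auto
  also have "\<dots> = (b \<otimes> c) \<otimes> d \<ominus> ((c \<otimes> b) \<otimes> d \<ominus> c \<otimes> (b \<otimes> d))"
    using left_symmetric[OF L d(1)] by simp
  also have "\<dots> \<in> zeta C"
    using BC[OF assms(1,2)] CB[OF assms(1,2)] \<open>b \<otimes> d \<in> D\<close> assms d
    by (intro submodule_minus submodules CC) auto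
  finally show "b \<otimes> (c \<otimes> d) \<in> zeta C" .
qed

lemma B_CD: "B \<bullet>\<^bsub>F,L\<^esub> (C \<bullet>\<^bsub>F,L\<^esub> D) \<subseteq> zeta B \<inter> zeta C"
  by (rule prod_span_nested_left[OF submodules(10) B_sub C_sub D_sub B_CD_elem])

lemma C_BD: "C \<bullet>\<^bsub>F,L\<^esub> (B \<bullet>\<^bsub>F,L\<^esub> D) \<subseteq> zeta B \<inter> zeta C"
  using two_step_ideal_sum.B_CD[OF swap] by (simp only: Int_commute)

section \<open>Products of L with D, and the ideals between K and D\<close>

text \<open>As \<open>D \<subseteq> B\<close>, both products have two factors in \<open>B\<close>,
  so \<open>BB\<close> applies; they stay in \<open>D\<close> because it is an ideal.\<close>

lemma BD_elem: "\<lbrakk>b \<in> B; d \<in> D\<rbrakk> \<Longrightarrow> b \<otimes> d \<in> D \<inter> zeta B \<and> d \<otimes> b \<in> D \<inter> zeta B"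
  using BB[of b d] BB[of d b] alg_idealD(3,4)[OF D_ideal B_carrier] by simp

lemma CD_elem: "\<lbrakk>c \<in> C; d \<in> D\<rbrakk> \<Longrightarrow> c \<otimes> d \<in> D \<inter> zeta C \<and> d \<otimes> c \<in> D \<inter> zeta C"
  using CC[of c d] CC[of d c] alg_idealD(3,4)[OF D_ideal C_carrier] by simp

lemma BD_zeta: "B \<bullet>\<^bsub>F,L\<^esub> D \<subseteq> D \<inter> zeta B" and CD_zeta: "C \<bullet>\<^bsub>F,L\<^esub> D \<subseteq> D \<inter> zeta C"
  and DB_zeta: "D \<bullet>\<^bsub>F,L\<^esub> B \<subseteq> D \<inter> zeta B" and DC_zeta: "D \<bullet>\<^bsub>F,L\<^esub> C \<subseteq> D \<inter> zeta C"
  by (rule prod_span_least; use BD_elem CD_elem submodules in simp)+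

lemma BD_sub: "B \<bullet>\<^bsub>F,L\<^esub> D \<subseteq> carrier L" and CD_sub: "C \<bullet>\<^bsub>F,L\<^esub> D \<subseteq> carrier L"
  and DB_sub: "D \<bullet>\<^bsub>F,L\<^esub> B \<subseteq> carrier L" and DC_sub: "D \<bullet>\<^bsub>F,L\<^esub> C \<subseteq> carrier L"
  and LD_sub: "carrier L \<bullet>\<^bsub>F,L\<^esub> D \<subseteq> carrier L" and DL_sub: "D \<bullet>\<^bsub>F,L\<^esub> carrier L \<subseteq> carrier L"
  by (intro prod_span_subset_carrier B_sub C_sub D_sub order_refl)+

text \<open>Writing the left factor as \<open>b \<oplus> c\<close> splits each generator; the
  converse is monotonicity.\<close>

lemma LD_eq: "carrier L \<bullet>\<^bsub>F,L\<^esub> D = (B \<bullet>\<^bsub>F,L\<^esub> D) <+>\<^bsub>L\<^esub> (C \<bullet>\<^bsub>F,L\<^esub> D)"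
proof
  show "carrier L \<bullet>\<^bsub>F,L\<^esub> D \<subseteq> (B \<bullet>\<^bsub>F,L\<^esub> D) <+>\<^bsub>L\<^esub> (C \<bullet>\<^bsub>F,L\<^esub> D)"
  proof (rule prod_span_least)
    fix x d assume x: "x \<in> carrier L" and d: "d \<in> D"
    from x obtain b c where bc: "b \<in> B" "c \<in> C" "x = b \<oplus> c" by (rule carrierE)
    then have "x \<otimes> d = b \<otimes> d \<oplus> c \<otimes> d" using d by (auto simp: B_carrier C_carrier prod_add_left)
    then show "x \<otimes> d \<in> (B \<bullet>\<^bsub>F,L\<^esub> D) <+>\<^bsub>L\<^esub> (C \<bullet>\<^bsub>F,L\<^esub> D)"
      using bc(1,2) d by (simp only: set_addI prod_spanI)
  qed (intro submodule_set_add submodule_prod_span B_sub C_sub D_sub)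
  show "(B \<bullet>\<^bsub>F,L\<^esub> D) <+>\<^bsub>L\<^esub> (C \<bullet>\<^bsub>F,L\<^esub> D) \<subseteq> carrier L \<bullet>\<^bsub>F,L\<^esub> D"
    by (intro set_add_least submodule_prod_span prod_span_mono B_sub C_sub D_sub order_refl)
qed

lemma DL: "D \<bullet>\<^bsub>F,L\<^esub> carrier L \<subseteq> (D \<bullet>\<^bsub>F,L\<^esub> B) <+>\<^bsub>L\<^esub> (D \<bullet>\<^bsub>F,L\<^esub> C)"
proof (rule prod_span_least)
  fix d x assume x: "x \<in> carrier L" and d: "d \<in> D"
  from x obtain b c where bc: "b \<in> B" "c \<in> C" "x = b \<oplus> c" by (rule carrierE)
  then have "d \<otimes> x = d \<otimes> b \<oplus> d \<otimes> c" using d by (auto simp: B_carrier C_carrier prod_add_right)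
  then show "d \<otimes> x \<in> (D \<bullet>\<^bsub>F,L\<^esub> B) <+>\<^bsub>L\<^esub> (D \<bullet>\<^bsub>F,L\<^esub> C)"
    using bc(1,2) d by (simp only: set_addI prod_spanI)
qed (intro submodule_set_add submodule_prod_span B_sub C_sub D_sub)

lemma BD_CD_K: "(B \<bullet>\<^bsub>F,L\<^esub> D) <+>\<^bsub>L\<^esub> (C \<bullet>\<^bsub>F,L\<^esub> D) \<subseteq> K"
  and DB_DC_K: "(D \<bullet>\<^bsub>F,L\<^esub> B) <+>\<^bsub>L\<^esub> (D \<bullet>\<^bsub>F,L\<^esub> C) \<subseteq> K"
  using BD_zeta CD_zeta DB_zeta DC_zeta zeta_B_D zeta_C_D
  by (intro set_add_least submodules; blast)+

lemma K_D: "K \<subseteq> D"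
  by (intro set_add_least submodules) auto

text \<open>What annihilates \<open>B\<close> or \<open>C\<close> annihilates the smaller set
  \<open>D\<close>, and \<open>zeta D\<close> is closed under sums.\<close>

lemma K_zeta: "K \<subseteq> zeta D"
  by (intro set_add_least submodules) (auto simp: zeta_iff)

lemma L_D_K: "\<lbrakk>x \<in> carrier L; d \<in> D\<rbrakk> \<Longrightarrow> x \<otimes> d \<in> K \<and> d \<otimes> x \<in> K"
  using prod_spanI[of x "carrier L" d D] prod_spanI[of d D x "carrier L"] LD_eq DL
    BD_CD_K DB_DC_K by blast

text \<open>By \<open>L_D_K\<close> all products of \<open>L\<close> with elements of
  \<open>D\<close> fall into \<open>K\<close>, hence into \<open>U\<close>. It is applied to
  \<open>K\<close> and to \<open>zeta D\<close>.\<close>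

lemma ideal_between:
  assumes "submodule U F L" "K \<subseteq> U" "U \<subseteq> D" shows "alg_ideal F L U"
  unfolding alg_ideal_def using assms by (auto dest: L_D_K)

lemma K_ideal: "alg_ideal F L K"
  by (rule ideal_between[OF submodules(9) order_refl K_D])

lemma zeta_D_ideal: "alg_ideal F L (zeta D)"
  by (rule ideal_between[OF submodules(6) K_zeta]) (auto simp: zeta_iff)

lemma K_abelian: "abelian_alg (L\<lparr>carrier := K\<rparr>)"
proof -
  have "x \<otimes> y = \<zero>" if "x \<in> K" "y \<in> K" for x y
    using subsetD[OF K_zeta that(1)] subsetD[OF K_D that(2)] by (simp add: zeta_iff)
  then show ?thesis by (simp add: abelian_alg_def)
qed

section \<open>Repeated left multiplication of D by L\<close>

text \<open>In \<open>(b \<oplus> c) \<otimes> (s \<oplus> t)\<close> the terms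
  \<open>b \<otimes> s\<close> and \<open>c \<otimes> t\<close> vanish, as \<open>s\<close> lies in
  \<open>zeta B\<close> and \<open>t\<close> in \<open>zeta C\<close>; only the mixed terms
  survive.\<close>

lemma L_BD_CD:
  "carrier L \<bullet>\<^bsub>F,L\<^esub> ((B \<bullet>\<^bsub>F,L\<^esub> D) <+>\<^bsub>L\<^esub> (C \<bullet>\<^bsub>F,L\<^esub> D))
    \<subseteq> (B \<bullet>\<^bsub>F,L\<^esub> (C \<bullet>\<^bsub>F,L\<^esub> D)) <+>\<^bsub>L\<^esub> (C \<bullet>\<^bsub>F,L\<^esub> (B \<bullet>\<^bsub>F,L\<^esub> D))" (is "_ \<subseteq> ?P")
proof (rule prod_span_least)
  show "submodule ?P F L"
    by (intro submodule_set_add submodule_prod_span B_sub C_sub BD_sub CD_sub)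
  fix x v assume x: "x \<in> carrier L" and v: "v \<in> (B \<bullet>\<^bsub>F,L\<^esub> D) <+>\<^bsub>L\<^esub> (C \<bullet>\<^bsub>F,L\<^esub> D)"
  from x obtain b c where bc: "b \<in> B" "c \<in> C" "x = b \<oplus> c" by (rule carrierE)
  from v obtain s t where st: "s \<in> B \<bullet>\<^bsub>F,L\<^esub> D" "t \<in> C \<bullet>\<^bsub>F,L\<^esub> D" "v = s \<oplus> t"
    by (auto simp: set_add_iff)
  have L: "b \<in> carrier L" "c \<in> carrier L" "s \<in> carrier L" "t \<in> carrier L"
    using bc st BD_sub CD_sub by (auto simp: B_carrier C_carrier)
  have "b \<otimes> s = \<zero>" "c \<otimes> t = \<zero>" using bc st BD_zeta CD_zeta by (auto simp: zeta_iff)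
  then have "x \<otimes> v = b \<otimes> t \<oplus> c \<otimes> s"
    using L by (simp add: bc st prod_add_left prod_add_right M.a_comm)
  then show "x \<otimes> v \<in> ?P" using bc(1,2) st(1,2) by (simp only: set_addI prod_spanI)
qed

lemma B_CD_C_BD:
  "(B \<bullet>\<^bsub>F,L\<^esub> (C \<bullet>\<^bsub>F,L\<^esub> D)) <+>\<^bsub>L\<^esub> (C \<bullet>\<^bsub>F,L\<^esub> (B \<bullet>\<^bsub>F,L\<^esub> D)) \<subseteq> zeta B \<inter> zeta C"
  by (intro set_add_least submodules B_CD C_BD)

text \<open>The subspace lies in \<open>ann_center L\<close>, so all its products with
  \<open>L\<close> are zero.\<close>

lemma B_CD_C_BD_ideal:
  "alg_ideal F L ((B \<bullet>\<^bsub>F,L\<^esub> (C \<bullet>\<^bsub>F,L\<^esub> D)) <+>\<^bsub>L\<^esub> (C \<bullet>\<^bsub>F,L\<^esub> (B \<bullet>\<^bsub>F,L\<^esub> D)))" (is "alg_ideal F L ?P")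
proof -
  have P: "submodule ?P F L"
    by (intro submodule_set_add submodule_prod_span B_sub C_sub BD_sub CD_sub)
  have "?P \<subseteq> ann_center L" using B_CD_C_BD inter_zeta by blast
  then show ?thesis
    using P submodule_zero[OF P] unfolding alg_ideal_def ann_center_def by auto
qed

text \<open>Two multiplications by \<open>L\<close> bring \<open>D\<close> into
  \<open>ann_center L\<close>, and the third one gives zero.\<close>

lemma L_L_L_D: "carrier L \<bullet>\<^bsub>F,L\<^esub> (carrier L \<bullet>\<^bsub>F,L\<^esub> (carrier L \<bullet>\<^bsub>F,L\<^esub> D)) = {\<zero>}"
proof
  have "carrier L \<bullet>\<^bsub>F,L\<^esub> (carrier L \<bullet>\<^bsub>F,L\<^esub> D) \<subseteq> ann_center L"
    unfolding LD_eq using L_BD_CD B_CD_C_BD inter_zeta by blast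
  then show "carrier L \<bullet>\<^bsub>F,L\<^esub> (carrier L \<bullet>\<^bsub>F,L\<^esub> (carrier L \<bullet>\<^bsub>F,L\<^esub> D)) \<subseteq> {\<zero>}"
    by (intro prod_span_least zero_submodule) (auto simp: ann_center_def)
  show "{\<zero>} \<subseteq> carrier L \<bullet>\<^bsub>F,L\<^esub> (carrier L \<bullet>\<^bsub>F,L\<^esub> (carrier L \<bullet>\<^bsub>F,L\<^esub> D))"
    using submodule_zero[OF submodule_prod_span] prod_span_subset_carrier LD_sub by auto
qed

section \<open>The subspace E and the powers of L\<close>

text \<open>The preimage in \<open>L\<close> of the annihilation center of
  \<open>L/D\<close>.\<close>

definition E :: "'a set" where
  "E = {x \<in> carrier L. \<forall>y\<in>carrier L. x \<otimes> y \<in> D \<and> y \<otimes> x \<in> D}"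

lemma E_submodule: "submodule E F L"
proof -
  have "E = {x \<in> carrier L. \<forall>u\<in>carrier L. u \<otimes> x \<in> D} \<inter> {x \<in> carrier L. \<forall>u\<in>carrier L. x \<otimes> u \<in> D}"
    by (auto simp: E_def)
  then show ?thesis
    by (simp only: submodule_Int submodule_left_residual submodule_right_residual submodules order_refl)
qed

lemma D_E: "D \<subseteq> E"
  using D_sub alg_idealD(3,4)[OF D_ideal] by (auto simp: E_def)

text \<open>For \<open>y = b \<oplus> c\<close> the part \<open>b\<close> contributes nothing, and
  the products of \<open>x \<in> B\<close> with \<open>c\<close> lie in \<open>D\<close> by
  \<open>BC\<close> and \<open>CB\<close>.\<close>

lemma zeta_B_E: "zeta B \<subseteq> E"
proof
  fix x assume "x \<in> zeta B"
  then have x: "x \<in> B" "x \<in> carrier L" "\<And>y. y \<in> B \<Longrightarrow> x \<otimes> y = \<zero> \<and> y \<otimes> x = \<zero>"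
    by (auto simp: zeta_iff B_carrier)
  have "x \<otimes> y \<in> D \<and> y \<otimes> x \<in> D" if y: "y \<in> carrier L" for y
  proof -
    obtain b c where bc: "b \<in> B" "c \<in> C" "y = b \<oplus> c" using y by (rule carrierE)
    then have "x \<otimes> y = x \<otimes> c" "y \<otimes> x = c \<otimes> x"
      using x by (simp_all add: B_carrier C_carrier prod_add_left prod_add_right)
    then show ?thesis using BC CB x bc by auto
  qed
  then show "x \<in> E" using x by (simp add: E_def)
qed

lemma zeta_C_E: "zeta C \<subseteq> E"
  using two_step_ideal_sum.zeta_B_E[OF swap] two_step_ideal_sum.E_def[OF swap]
  by (simp add: E_def Int_commute)

text \<open>Expanding both factors gives four products: the pure ones lie in \<open>zeta B\<close>
  and \<open>zeta C\<close>, the mixed ones in \<open>D\<close>, and \<open>E\<close> contains all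
  three sets.\<close>

lemma L_L_E:
  assumes "x \<in> carrier L" "y \<in> carrier L" shows "x \<otimes> y \<in> E"
proof -
  obtain b c where bc: "b \<in> B" "c \<in> C" "x = b \<oplus> c" using assms(1) by (rule carrierE)
  obtain b' c' where bc': "b' \<in> B" "c' \<in> C" "y = b' \<oplus> c'" using assms(2) by (rule carrierE)
  have "x \<otimes> y = (b \<otimes> b' \<oplus> b \<otimes> c') \<oplus> (c \<otimes> b' \<oplus> c \<otimes> c')"
    using bc bc' by (simp add: B_carrier C_carrier prod_add_left prod_add_right M.a_ac)
  also have "\<dots> \<in> E"
    using bc bc'
    by (intro submoduleE(5)[OF E_submodule] subsetD[OF zeta_B_E BB] subsetD[OF zeta_C_E CC]
        subsetD[OF D_E BC] subsetD[OF D_E CB])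
  finally show ?thesis .
qed

text \<open>The sixth power has six factors: the innermost three give a subspace of
  \<open>D\<close>, since \<open>L_L_E\<close> puts the inner product into \<open>E\<close>, and the
  other three annihilate it by \<open>L_L_L_D\<close>.\<close>

lemma left_power_6: "left_power F L 6 = {\<zero>}"
proof -
  let ?L = "carrier L"
  have eq: "left_power F L 6 =
      ?L \<bullet>\<^bsub>F,L\<^esub> (?L \<bullet>\<^bsub>F,L\<^esub> (?L \<bullet>\<^bsub>F,L\<^esub> (?L \<bullet>\<^bsub>F,L\<^esub> (?L \<bullet>\<^bsub>F,L\<^esub> ?L))))"
    by (simp add: eval_nat_numeral)
  have D: "?L \<bullet>\<^bsub>F,L\<^esub> (?L \<bullet>\<^bsub>F,L\<^esub> ?L) \<subseteq> D"
    by (rule prod_span_nested_left[OF submodules(3)]) (use L_L_E in \<open>auto simp: E_def\<close>)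
  have "left_power F L 6 \<subseteq> ?L \<bullet>\<^bsub>F,L\<^esub> (?L \<bullet>\<^bsub>F,L\<^esub> (?L \<bullet>\<^bsub>F,L\<^esub> D))"
    unfolding eq by (intro prod_span_mono D prod_span_subset_carrier order_refl D_sub)
  moreover have "\<zero> \<in> left_power F L 6"
    unfolding eq by (intro submodule_zero submodule_prod_span prod_span_subset_carrier order_refl)
  ultimately show ?thesis unfolding L_L_L_D by blast
qed

text \<open>Three factors reach \<open>D\<close>, the fourth leads from \<open>D\<close> into
  \<open>K\<close>, and the fifth stays there because \<open>K\<close> is an ideal.\<close>

lemma right_power_5: "right_power F L 5 \<subseteq> K"
proof -
  let ?L = "carrier L"
  have "(?L \<bullet>\<^bsub>F,L\<^esub> ?L) \<bullet>\<^bsub>F,L\<^esub> ?L \<subseteq> D"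
    by (rule prod_span_nested_right[OF submodules(3)]) (use L_L_E in \<open>auto simp: E_def\<close>)
  then have "((?L \<bullet>\<^bsub>F,L\<^esub> ?L) \<bullet>\<^bsub>F,L\<^esub> ?L) \<bullet>\<^bsub>F,L\<^esub> ?L \<subseteq> K"
    by (intro prod_span_least submodules) (blast dest: L_D_K)
  then have "(((?L \<bullet>\<^bsub>F,L\<^esub> ?L) \<bullet>\<^bsub>F,L\<^esub> ?L) \<bullet>\<^bsub>F,L\<^esub> ?L) \<bullet>\<^bsub>F,L\<^esub> ?L \<subseteq> K"
    by (intro prod_span_least submodules) (blast intro: alg_idealD(4)[OF K_ideal])
  then show ?thesis by (simp add: eval_nat_numeral)
qed

section \<open>Repeated right multiplication of D by L\<close>

text \<open>The mirror image of \<open>L_BD_CD\<close>: with \<open>v = s \<oplus> t\<close> the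
  products \<open>s \<otimes> b\<close> and \<open>t \<otimes> c\<close> vanish.\<close>

lemma DL_L:
  "(D \<bullet>\<^bsub>F,L\<^esub> carrier L) \<bullet>\<^bsub>F,L\<^esub> carrier L
    \<subseteq> ((D \<bullet>\<^bsub>F,L\<^esub> C) \<bullet>\<^bsub>F,L\<^esub> B) <+>\<^bsub>L\<^esub> ((D \<bullet>\<^bsub>F,L\<^esub> B) \<bullet>\<^bsub>F,L\<^esub> C)" (is "_ \<subseteq> ?P")
proof (rule prod_span_least)
  show "submodule ?P F L"
    by (intro submodule_set_add submodule_prod_span B_sub C_sub DB_sub DC_sub)
  fix v x assume x: "x \<in> carrier L" and "v \<in> D \<bullet>\<^bsub>F,L\<^esub> carrier L"
  then obtain s t where st: "s \<in> D \<bullet>\<^bsub>F,L\<^esub> B" "t \<in> D \<bullet>\<^bsub>F,L\<^esub> C" "v = s \<oplus> t"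
    using DL by (force simp: set_add_iff)
  from x obtain b c where bc: "b \<in> B" "c \<in> C" "x = b \<oplus> c" by (rule carrierE)
  have L: "b \<in> carrier L" "c \<in> carrier L" "s \<in> carrier L" "t \<in> carrier L"
    using bc st DB_sub DC_sub by (auto simp: B_carrier C_carrier)
  have "s \<otimes> b = \<zero>" "t \<otimes> c = \<zero>" using bc st DB_zeta DC_zeta by (auto simp: zeta_iff)
  then have "v \<otimes> x = t \<otimes> b \<oplus> s \<otimes> c"
    using L by (simp add: bc st prod_add_left prod_add_right M.a_comm)
  then show "v \<otimes> x \<in> ?P" using bc(1,2) st(1,2) by (simp only: set_addI prod_spanI)
qed

text \<open>The inner products already lie in \<open>D\<close>, so one more factor from
  \<open>L\<close> takes them into \<open>K\<close>.\<close>

lemma DCB_DBC_K: "((D \<bullet>\<^bsub>F,L\<^esub> C) \<bullet>\<^bsub>F,L\<^esub> B) <+>\<^bsub>L\<^esub> ((D \<bullet>\<^bsub>F,L\<^esub> B) \<bullet>\<^bsub>F,L\<^esub> C) \<subseteq> K"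
  by (intro set_add_least prod_span_least submodules)
    (use DB_zeta DC_zeta in \<open>blast dest: L_D_K[OF B_carrier] L_D_K[OF C_carrier]\<close>)+

lemma DL_D: "D \<bullet>\<^bsub>F,L\<^esub> carrier L \<subseteq> D"
  using DL DB_DC_K K_D by blast

text \<open>The innermost product is absorbed by \<open>D\<close>, which reduces the claim to
  \<open>DL_L\<close>.\<close>

lemma DLL_L:
  "((D \<bullet>\<^bsub>F,L\<^esub> carrier L) \<bullet>\<^bsub>F,L\<^esub> carrier L) \<bullet>\<^bsub>F,L\<^esub> carrier L
    \<subseteq> ((D \<bullet>\<^bsub>F,L\<^esub> C) \<bullet>\<^bsub>F,L\<^esub> B) <+>\<^bsub>L\<^esub> ((D \<bullet>\<^bsub>F,L\<^esub> B) \<bullet>\<^bsub>F,L\<^esub> C)"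
  by (rule order_trans[OF _ DL_L]) (intro prod_span_mono DL_D D_sub DL_sub order_refl)

section \<open>The factor algebra modulo K\<close>

lemma factor_upper_central: "upper_central (factor_alg L K) 3 = carrier (factor_alg L K)"
proof -
  let ?Q = "factor_alg L K"
  interpret K: bilinear_algebra_ideal F L K by unfold_locales (rule K_ideal)
  interpret Q: bilinear_algebra F ?Q by (rule K.bilinear_algebra_factor)
  \<comment> \<open>The recursion of the upper central series of the factor, read on representatives
    in \<open>L\<close>.\<close>
  have step: "K +>\<^bsub>L\<^esub> x \<in> upper_central ?Q (Suc n)"
    if "x \<in> carrier L" "\<And>y. y \<in> carrier L \<Longrightarrow>
        K +>\<^bsub>L\<^esub> x \<otimes> y \<in> upper_central ?Q n \<and> K +>\<^bsub>L\<^esub> y \<otimes> x \<in> upper_central ?Q n" for x n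
    using that unfolding Q.upper_central_Suc by (auto simp: K.carrier_factor)
  \<comment> \<open>Products of \<open>D\<close> with \<open>L\<close> lie in \<open>K\<close>,
    whose coset is zero.\<close>
  have "K +>\<^bsub>L\<^esub> x \<in> upper_central ?Q (Suc 0)" if "x \<in> D" for x
    using that D_sub L_D_K by (intro step) (auto simp: K.a_rcos_const)
  \<comment> \<open>\<open>E\<close> is defined so that its products with \<open>L\<close> lie in
    \<open>D\<close>.\<close>
  then have "K +>\<^bsub>L\<^esub> x \<in> upper_central ?Q (Suc (Suc 0))" if "x \<in> E" for x
    using that by (intro step) (auto simp only: E_def mem_Collect_eq)
  \<comment> \<open>By \<open>L_L_E\<close> all products in \<open>L\<close> lie in
    \<open>E\<close>, so the third term is everything.\<close>
  then have "K +>\<^bsub>L\<^esub> x \<in> upper_central ?Q (Suc (Suc (Suc 0)))" if "x \<in> carrier L" for x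
    using that L_L_E by (intro step) auto
  then have "carrier ?Q \<subseteq> upper_central ?Q 3"
    unfolding K.carrier_factor numeral_3_eq_3 by blast
  then show ?thesis using Q.alg_idealD(2)[OF Q.upper_central_ideal] by blast
qed

lemma factor_nilpotent: "nilpotent_alg F (factor_alg L K)"
proof -
  interpret K: bilinear_algebra_ideal F L K by unfold_locales (rule K_ideal)
  interpret Q: bilinear_algebra F "factor_alg L K" by (rule K.bilinear_algebra_factor)
  show ?thesis by (rule Q.nilpotent_algI[OF factor_upper_central])
qed

lemma factor_uzl: "uzl (factor_alg L K) \<le> 3"
  unfolding uzl_def by (rule Least_le) (rule factor_upper_central)

end

theorem theoremC:
  fixes F :: "('f, 'm) ring_scheme" and L :: "('f, 'a, 'n) module_scheme"
    and B C D K :: "'a set"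
  assumes "left_pre_lie_algebra F L"
    and "alg_ideal F L B" and "alg_ideal F L C"
    and "carrier L = B <+>\<^bsub>L\<^esub> C"
    and "B = upper_central (L\<lparr>carrier := B\<rparr>) 2"
    and "C = upper_central (L\<lparr>carrier := C\<rparr>) 2"
    and D: "D = B \<inter> C"
    and K: "K = (D \<inter> ann_center (L\<lparr>carrier := B\<rparr>)) <+>\<^bsub>L\<^esub>
                (D \<inter> ann_center (L\<lparr>carrier := C\<rparr>))"
  shows
    \<comment> \<open>(i)\<close>
    "ann_center (L\<lparr>carrier := B\<rparr>) \<inter> ann_center (L\<lparr>carrier := C\<rparr>) \<subseteq> ann_center L
    \<and> \<comment> \<open>(ii)\<close>
    (B \<bullet>\<^bsub>F,L\<^esub> (C \<bullet>\<^bsub>F,L\<^esub> D)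
        \<subseteq> ann_center (L\<lparr>carrier := B\<rparr>) \<inter> ann_center (L\<lparr>carrier := C\<rparr>)
     \<and> C \<bullet>\<^bsub>F,L\<^esub> (B \<bullet>\<^bsub>F,L\<^esub> D)
        \<subseteq> ann_center (L\<lparr>carrier := B\<rparr>) \<inter> ann_center (L\<lparr>carrier := C\<rparr>))
    \<and> \<comment> \<open>(iii)\<close>
    (carrier L \<bullet>\<^bsub>F,L\<^esub> D = (B \<bullet>\<^bsub>F,L\<^esub> D) <+>\<^bsub>L\<^esub> (C \<bullet>\<^bsub>F,L\<^esub> D)
     \<and> (B \<bullet>\<^bsub>F,L\<^esub> D) <+>\<^bsub>L\<^esub> (C \<bullet>\<^bsub>F,L\<^esub> D) \<subseteq> K
     \<and> K \<subseteq> ann_center (L\<lparr>carrier := D\<rparr>))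
    \<and> \<comment> \<open>(iv)\<close>
    (carrier L \<bullet>\<^bsub>F,L\<^esub> ((B \<bullet>\<^bsub>F,L\<^esub> D) <+>\<^bsub>L\<^esub> (C \<bullet>\<^bsub>F,L\<^esub> D))
        \<subseteq> (B \<bullet>\<^bsub>F,L\<^esub> (C \<bullet>\<^bsub>F,L\<^esub> D)) <+>\<^bsub>L\<^esub> (C \<bullet>\<^bsub>F,L\<^esub> (B \<bullet>\<^bsub>F,L\<^esub> D))
     \<and> (B \<bullet>\<^bsub>F,L\<^esub> (C \<bullet>\<^bsub>F,L\<^esub> D)) <+>\<^bsub>L\<^esub> (C \<bullet>\<^bsub>F,L\<^esub> (B \<bullet>\<^bsub>F,L\<^esub> D))
        \<subseteq> ann_center (L\<lparr>carrier := B\<rparr>) \<inter> ann_center (L\<lparr>carrier := C\<rparr>)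
     \<and> ann_center (L\<lparr>carrier := B\<rparr>) \<inter> ann_center (L\<lparr>carrier := C\<rparr>) \<subseteq> ann_center L
     \<and> alg_ideal F L
          ((B \<bullet>\<^bsub>F,L\<^esub> (C \<bullet>\<^bsub>F,L\<^esub> D)) <+>\<^bsub>L\<^esub> (C \<bullet>\<^bsub>F,L\<^esub> (B \<bullet>\<^bsub>F,L\<^esub> D))))
    \<and> \<comment> \<open>(v)\<close>
    carrier L \<bullet>\<^bsub>F,L\<^esub> (carrier L \<bullet>\<^bsub>F,L\<^esub> (carrier L \<bullet>\<^bsub>F,L\<^esub> D)) = {\<zero>\<^bsub>L\<^esub>}
    \<and> \<comment> \<open>(vi)\<close>
    left_power F L 6 = {\<zero>\<^bsub>L\<^esub>}
    \<and> \<comment> \<open>(vii)\<close>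
    (D \<bullet>\<^bsub>F,L\<^esub> carrier L \<subseteq> (D \<bullet>\<^bsub>F,L\<^esub> B) <+>\<^bsub>L\<^esub> (D \<bullet>\<^bsub>F,L\<^esub> C)
     \<and> (D \<bullet>\<^bsub>F,L\<^esub> B) <+>\<^bsub>L\<^esub> (D \<bullet>\<^bsub>F,L\<^esub> C) \<subseteq> K
     \<and> K \<subseteq> ann_center (L\<lparr>carrier := D\<rparr>))
    \<and> \<comment> \<open>(viii)\<close>
    (alg_ideal F L K \<and> abelian_alg (L\<lparr>carrier := K\<rparr>))
    \<and> \<comment> \<open>(ix)\<close>
    alg_ideal F L (ann_center (L\<lparr>carrier := D\<rparr>))
    \<and> \<comment> \<open>(x)\<close>
    ((D \<bullet>\<^bsub>F,L\<^esub> carrier L) \<bullet>\<^bsub>F,L\<^esub> carrier L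
        \<subseteq> ((D \<bullet>\<^bsub>F,L\<^esub> C) \<bullet>\<^bsub>F,L\<^esub> B) <+>\<^bsub>L\<^esub> ((D \<bullet>\<^bsub>F,L\<^esub> B) \<bullet>\<^bsub>F,L\<^esub> C)
     \<and> ((D \<bullet>\<^bsub>F,L\<^esub> C) \<bullet>\<^bsub>F,L\<^esub> B) <+>\<^bsub>L\<^esub> ((D \<bullet>\<^bsub>F,L\<^esub> B) \<bullet>\<^bsub>F,L\<^esub> C) \<subseteq> K
     \<and> K \<subseteq> ann_center (L\<lparr>carrier := D\<rparr>)
     \<and> ((D \<bullet>\<^bsub>F,L\<^esub> carrier L) \<bullet>\<^bsub>F,L\<^esub> carrier L) \<bullet>\<^bsub>F,L\<^esub> carrier L
        \<subseteq> ((D \<bullet>\<^bsub>F,L\<^esub> C) \<bullet>\<^bsub>F,L\<^esub> B) <+>\<^bsub>L\<^esub> ((D \<bullet>\<^bsub>F,L\<^esub> B) \<bullet>\<^bsub>F,L\<^esub> C)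
     \<and> ((D \<bullet>\<^bsub>F,L\<^esub> C) \<bullet>\<^bsub>F,L\<^esub> B) <+>\<^bsub>L\<^esub> ((D \<bullet>\<^bsub>F,L\<^esub> B) \<bullet>\<^bsub>F,L\<^esub> C)
        \<subseteq> ann_center (L\<lparr>carrier := D\<rparr>))
    \<and> \<comment> \<open>(xi)\<close>
    (right_power F L 5 \<subseteq> K \<and> K \<subseteq> ann_center (L\<lparr>carrier := D\<rparr>))
    \<and> \<comment> \<open>(xii)\<close>
    (nilpotent_alg F (factor_alg L K) \<and> uzl (factor_alg L K) \<le> 3)"
proof -
  interpret L: left_pre_lie_algebra F L by fact
  \<comment> \<open>The equations with \<open>upper_central\<close> are turned into
    \<open>BB\<close> and \<open>CC\<close> by \<open>upper_central_2_prod\<close>.\<close>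
  interpret two_step_ideal_sum F L B C
    by unfold_locales
      (fact assms L.upper_central_2_prod[OF assms(2,5)] L.upper_central_2_prod[OF assms(3,6)])+
  show ?thesis
    unfolding D K
    by (intro conjI inter_zeta B_CD C_BD LD_eq BD_CD_K K_zeta L_BD_CD B_CD_C_BD B_CD_C_BD_ideal
        L_L_L_D left_power_6 DL DB_DC_K K_ideal K_abelian zeta_D_ideal DL_L DCB_DBC_K DLL_L
        order_trans[OF DCB_DBC_K K_zeta] right_power_5 factor_nilpotent factor_uzl)
qed

end
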